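(* Let $\mathcal{G}=(\mathbf{A},\mathbf{B},\mathbf{C},\mathbf{D})$ be a minimal, asymptotically stable linear system with $\mathbf{A}\in\mathbb{R}^{n\times n}$, $\mathbf{B}\in\mathbb{R}^{n\times m}$, $\mathbf{C}\in\mathbb{R}^{m\times n}$, $\mathbf{D}\in\mathbb{R}^{m\times m}$ and transfer function $\mathbf{G}(s)=\mathbf{C}(s\mathbf{I}_n-\mathbf{A})^{-1}\mathbf{B}+\mathbf{D}$. Assume $\mathcal{G}$ is strictly positive real, i.e. $\mathbf{G}(\dot{\imath}\omega)+\mathbf{G}(-\dot{\imath}\omega)^{\mathsf T}\succ\mathbf{0}$ for all $\omega\in\mathbb{R}$, and that $\mathbf{R}:=\mathbf{D}+\mathbf{D}^{\mathsf T}\succ\mathbf{0}$. Let $\mathbf{Q}_{\mathcal M}^{-},\mathbf{P}_{\mathcal N}^{-}\in\mathbb{R}^{n\times n}$ be the minimal solutions of the algebraic Riccati equations $$\mathbf{A}^{\mathsf T}\mathbf{Q}_{\mathcal M}+\mathbf{Q}_{\mathcal M}\mathbf{A}+(\mathbf{C}-\mathbf{B}^{\mathsf T}\mathbf{Q}_{\mathcal M})^{\mathsf T}(\mathbf{D}+\mathbf{D}^{\mathsf T})^{-1}(\mathbf{C}-\mathbf{B}^{\mathsf T}\mathbf{Q}_{\mathcal M})=\mathbf{0},$$ $$\mathbf{A}\mathbf{P}_{\mathcal N}+\mathbf{P}_{\mathcal N}\mathbf{A}^{\mathsf T}+(\mathbf{B}-\mathbf{P}_{\mathcal N}\mathbf{C}^{\mathsf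 T})(\mathbf{D}+\mathbf{D}^{\mathsf T})^{-1}(\mathbf{B}-\mathbf{P}_{\mathcal N}\mathbf{C}^{\mathsf T})^{\mathsf T}=\mathbf{0},$$ respectively. Set $$\mathbf{C}_{\mathcal M}:=\mathbf{R}^{-1/2}(\mathbf{C}-\mathbf{B}^{\mathsf T}\mathbf{Q}_{\mathcal M}^{-})\in\mathbb{R}^{m\times n},\qquad \mathbf{M}(s):=\mathbf{C}_{\mathcal M}(s\mathbf{I}_n-\mathbf{A})^{-1}\mathbf{B}+\mathbf{R}^{1/2},$$ $$\mathbf{B}_{\mathcal N}:=(\mathbf{B}-\mathbf{P}_{\mathcal N}^{-}\mathbf{C}^{\mathsf T})\mathbf{R}^{-1/2}\in\mathbb{R}^{n\times m},\qquad \mathbf{N}(s):=\mathbf{C}(s\mathbf{I}_n-\mathbf{A})^{-1}\mathbf{B}_{\mathcal N}+\mathbf{R}^{1/2}.$$ With the choices $\mathbf{B}_{\mathcal X}=\mathbf{B}_{\mathcal N}$ and $\mathbf{C}_{\mathcal Y}=\mathbf{C}_{\mathcal M}$, define $$\mathbf{G}_{\sigma,\mathbf{A}}(s)=\mathbf{C}_{\mathcal Y}(s\mathbf{I}_n-\mathbf{A})^{-1}\mathbf{B}_{\mathcal X},\quad \mathbf{G}_{\mathbf{B}}(s)=\mathbf{C}_{\mathcal Y}(s\mathbf{I}_n-\mathbf{A})^{-1}\mathbf{B},\quad \mathbf{G}_{\mathbf{C}}(s)=\mathbf{C}(s\mathbf{I}_n-\mathbf{A})^{-1}\mathbf{B}_{\mathcal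 X}.$$ Then $$\mathbf{G}_{\sigma,\mathbf{A}}(s)=\Big[\big(\mathbf{M}(-s)^{\mathsf T}\big)^{-1}\mathbf{N}_\infty(s)\Big]_+,\qquad \mathbf{G}_{\mathbf{B}}(s)=\mathbf{M}_\infty(s),\qquad \mathbf{G}_{\mathbf{C}}(s)=\mathbf{N}_\infty(s).$$
   Context: A quadruple $(\mathbf{A},\mathbf{B},\mathbf{C},\mathbf{D})$ denotes the system $\dot{\mathbf x}=\mathbf{A}\mathbf{x}+\mathbf{B}\mathbf{u}$, $\mathbf{y}=\mathbf{C}\mathbf{x}+\mathbf{D}\mathbf{u}$; it is asymptotically stable if $\mathbf{A}$ is Hurwitz (all eigenvalues in the open left half-plane), and minimal if it is reachable and observable. $\dot{\imath}$ is the imaginary unit; $\succ,\succeq$ is the Loewner order. For a proper rational matrix function $\mathbf{F}(s)$, $\mathbf{F}_\infty(s):=\mathbf{F}(s)-\lim_{z\to\infty}\mathbf{F}(z)$ is its strictly proper part. For a strictly proper rational matrix function $\mathbf{F}$, $[\mathbf{F}(s)]_+$ denotes its purely stable part: the strictly proper summand with all poles in the open left half-plane in the (unique) decomposition of $\mathbf{F}$ into such a summand plus a strictly proper summand with no poles in the open left half-plane. The minimal solution of each Riccati equation is the symmetric positive definite solution that is $\preceq$ every symmetric solution of that equation; it is the stabilizing solution, meaning that $\mathbf{A}-\mathbf{B}\mathbf{R}^{-1}(\mathbf{C}-\mathbf{B}^{\mathsf T}\mathbf{Q}_{\mathcal M}^{-})$, respectively $\mathbf{A}-(\mathbf{B}-\mathbf{P}_{\mathcal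 N}^{-}\mathbf{C}^{\mathsf T})\mathbf{R}^{-1}\mathbf{C}$, is Hurwitz. The powers $\mathbf{R}^{\pm1/2}$ are the symmetric positive definite ones. $\mathbf{M}$ and $\mathbf{N}$ are minimum phase spectral factors of the Popov function: $\mathbf{G}(s)+\mathbf{G}(-s)^{\mathsf T}=\mathbf{M}(-s)^{\mathsf T}\mathbf{M}(s)=\mathbf{N}(s)\mathbf{N}(-s)^{\mathsf T}$. *)

theory Defs
  imports
    "HOL-Analysis.Analysis"
    "HOL-Computational_Algebra.Polynomial_Factorial"
    "HOL-Computational_Algebra.Fundamental_Theorem_Algebra"
    "HOL-Computational_Algebra.Field_as_Ring"
begin

section \<open>Rational functions and rational matrix functions\<close>

text \<open>
  Rational functions are elements of the field of fractions of the polynomials in one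
  variable over the complex numbers, so an equation between rational matrix functions is an
  equation in that field, and \<^const>\<open>matrix_inv\<close> is the inverse over that field.
\<close>

type_synonym ratfun = "complex poly fract"

definition rf_const :: "complex \<Rightarrow> ratfun" where
  "rf_const c = to_fract [:c:]"

definition rf_var :: ratfun where
  "rf_var = to_fract [:0, 1:]"

text \<open>
  \<^const>\<open>quot_of_fract\<close> yields the representation in lowest terms.  At a pole, \<open>rf_eval\<close> has
  the junk value \<open>0\<close>.
\<close>

definition rf_eval :: "ratfun \<Rightarrow> complex \<Rightarrow> complex" where
  "rf_eval f z = poly (fst (quot_of_fract f)) z / poly (snd (quot_of_fract f)) z"

definition rf_poles :: "ratfun \<Rightarrow> complex set" where
  "rf_poles f = {z. poly (snd (quot_of_fract f)) z = 0}"

text \<open>The substitution of \<open>-s\<close> for the variable \<open>s\<close>.\<close>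

definition rf_reflect :: "ratfun \<Rightarrow> ratfun" where
  "rf_reflect f = Fract (pcompose (fst (quot_of_fract f)) [:0, -1:])
                        (pcompose (snd (quot_of_fract f)) [:0, -1:])"

definition rm_eval :: "ratfun^'n^'m \<Rightarrow> complex \<Rightarrow> complex^'n^'m" where
  "rm_eval F z = map_matrix (\<lambda>f. rf_eval f z) F"

definition rm_poles :: "ratfun^'n^'m \<Rightarrow> complex set" where
  "rm_poles F = (\<Union>i j. rf_poles (F $ i $ j))"

definition rm_reflect :: "ratfun^'n^'m \<Rightarrow> ratfun^'n^'m" where
  "rm_reflect F = map_matrix rf_reflect F"

definition strictly_proper :: "ratfun^'n^'m \<Rightarrow> bool" where
  "strictly_proper F \<longleftrightarrow> (\<forall>i j. (rf_eval (F $ i $ j) \<longlongrightarrow> 0) at_infinity)"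

text \<open>This is meaningful for proper \<open>F\<close>, that is, if the limit exists.\<close>

definition strictly_proper_part :: "ratfun^'n^'m \<Rightarrow> ratfun^'n^'m" where
  "strictly_proper_part F = F - map_matrix rf_const (Lim at_infinity (rm_eval F))"

definition is_stable_part :: "ratfun^'n^'m \<Rightarrow> ratfun^'n^'m \<Rightarrow> bool" where
  "is_stable_part F P \<longleftrightarrow>
     strictly_proper P \<and> rm_poles P \<subseteq> {z. Re z < 0} \<and>
     strictly_proper (F - P) \<and> rm_poles (F - P) \<inter> {z. Re z < 0} = {}"

definition stable_part :: "ratfun^'n^'m \<Rightarrow> ratfun^'n^'m" where
  "stable_part F = (THE P. is_stable_part F P)"

text \<open>There is at most one such summand, so that \<open>stable_part\<close> is characterised by
  \<open>is_stable_part\<close>.\<close>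

lemma rf_pole_iff: "z \<notin> rf_poles f \<longleftrightarrow> (\<exists>p q. f = Fract p q \<and> poly q z \<noteq> 0)"
proof
  assume "z \<notin> rf_poles f"
  then show "\<exists>p q. f = Fract p q \<and> poly q z \<noteq> 0"
    by (intro exI[of _ "fst (quot_of_fract f)"] exI[of _ "snd (quot_of_fract f)"])
       (simp add: rf_poles_def)
next
  assume "\<exists>p q. f = Fract p q \<and> poly q z \<noteq> 0"
  then obtain p q where f: "f = Fract p q" and q: "poly q z \<noteq> 0" by blast
  define a b where "a = fst (quot_of_fract f)" and "b = snd (quot_of_fract f)"
  have b0: "b \<noteq> 0" and cop: "coprime a b" and fab: "f = Fract a b"
    by (auto simp: a_def b_def intro: coprime_quot_of_fract)
  have q0: "q \<noteq> 0" using q by auto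
  have "a * q = p * b" using f fab b0 q0 by (simp add: eq_fract)
  then have "b dvd a * q" by simp
  then have "b dvd q" using cop by (simp add: coprime_commute coprime_dvd_mult_right_iff)
  then have "poly b z \<noteq> 0" using q by (auto elim!: dvdE)
  then show "z \<notin> rf_poles f" by (simp add: rf_poles_def b_def)
qed

lemma rf_eval_Fract:
  assumes "poly q z \<noteq> 0"
  shows "rf_eval (Fract p q) z = poly p z / poly q z"
proof -
  define a b where "a = fst (quot_of_fract (Fract p q))" and "b = snd (quot_of_fract (Fract p q))"
  have "z \<notin> rf_poles (Fract p q)" using assms rf_pole_iff by blast
  then have b: "poly b z \<noteq> 0" by (simp add: rf_poles_def b_def)
  have "b \<noteq> 0" "q \<noteq> 0" using b assms by auto
  moreover have "Fract a b = Fract p q" by (simp add: a_def b_def)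
  ultimately have "a * q = p * b" by (simp add: eq_fract)
  then have "poly (a * q) z = poly (p * b) z" by simp
  then have "poly a z * poly q z = poly p z * poly b z" by simp
  then show ?thesis using b assms 
    unfolding rf_eval_def a_def [symmetric] b_def [symmetric] by (simp add: frac_eq_eq)
qed

lemma rf_eval_reflect:
  assumes "- z \<notin> rf_poles f"
  shows "rf_eval (rf_reflect f) z = rf_eval f (- z)"
proof -
  have "poly (pcompose (snd (quot_of_fract f)) [:0, -1:]) z \<noteq> 0"
    using assms by (simp add: poly_pcompose rf_poles_def)
  then show ?thesis
    unfolding rf_reflect_def by (simp add: rf_eval_Fract) (simp add: poly_pcompose rf_eval_def)
qed

lemma
  assumes "z \<notin> rf_poles f" "z \<notin> rf_poles g"
  shows rf_poles_diff: "z \<notin> rf_poles (f - g)"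
    and rf_eval_diff: "rf_eval (f - g) z = rf_eval f z - rf_eval g z"
proof -
  obtain p q p' q' where f: "f = Fract p q" "poly q z \<noteq> 0" and g: "g = Fract p' q'" "poly q' z \<noteq> 0"
    using assms rf_pole_iff by meson
  have "q \<noteq> 0" "q' \<noteq> 0" using f g by auto
  then have d: "f - g = Fract (p * q' - p' * q) (q * q')" by (simp add: f g)
  have n: "poly (q * q') z \<noteq> 0" using f g by simp
  show "z \<notin> rf_poles (f - g)" using d n rf_pole_iff by blast
  show "rf_eval (f - g) z = rf_eval f z - rf_eval g z"
    using f g unfolding d rf_eval_Fract[OF n] by (simp add: rf_eval_Fract diff_divide_eq_iff divide_diff_eq_iff)
qed

lemma finite_rf_poles: "finite (rf_poles f)"
  unfolding rf_poles_def by (simp add: poly_roots_finite)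

lemma rf_eq_0:
  assumes "rf_poles f = {}" "(rf_eval f \<longlongrightarrow> 0) at_infinity"
  shows "f = 0"
proof -
  define a b where "a = fst (quot_of_fract f)" and "b = snd (quot_of_fract f)"
  have b: "poly b z \<noteq> 0" for z using assms(1) by (auto simp: rf_poles_def b_def)
  then have "constant (poly b)" using fundamental_theorem_of_algebra by blast
  then obtain c where c: "poly b z = c" for z unfolding constant_def by metis
  then have c0: "c \<noteq> 0" using b by metis
  have ev: "rf_eval f = (\<lambda>z. poly a z / c)" using c by (auto simp: rf_eval_def a_def b_def)
  have lim: "((\<lambda>z. poly a z) \<longlongrightarrow> 0) at_infinity"
    using tendsto_mult_right[OF assms(2), of c] c0 by (simp add: ev)
  have "a = 0"
  proof (cases "degree a = 0")
    case True
    then obtain k where k: "a = [:k:]" by (rule degree_eq_zeroE)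
    have "((\<lambda>z::complex. k) \<longlongrightarrow> 0) at_infinity" using lim by (simp add: k)
    then have "k = 0"
      by (simp add: tendsto_const_iff[OF trivial_limit_at_infinity])
    then show ?thesis by (simp add: k)
  next
    case False
    then have "LIM z at_infinity. poly a z :> at_infinity"
      by (intro filterlim_poly_at_infinity) simp
    then show ?thesis
      using lim not_tendsto_and_filterlim_at_infinity[OF trivial_limit_at_infinity] by blast
  qed
  then show ?thesis 
    using Fract_quot_of_fract[of f] by (simp add: a_def fract_collapse)
qed

lemma is_stable_part_unique:
  fixes F :: "ratfun^'a^'b"
  assumes "is_stable_part F P" "is_stable_part F P'"
  shows "P = P'"
proof -
  have "P $ i $ j - P' $ i $ j = 0" for i j
  proof (rule rf_eq_0)
    let ?f = "P $ i $ j" and ?g = "P' $ i $ j" and ?h = "F $ i $ j"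
    have sub: "rf_poles (X $ i $ j) \<subseteq> rm_poles X" for X :: "ratfun^'a^'b"
      unfolding rm_poles_def by auto
    have st: "rm_poles P \<subseteq> {z. Re z < 0}" "rm_poles P' \<subseteq> {z. Re z < 0}"
      "rm_poles (F - P) \<inter> {z. Re z < 0} = {}" "rm_poles (F - P') \<inter> {z. Re z < 0} = {}"
      using assms by (simp_all only: is_stable_part_def)
    have A: "z \<notin> rf_poles ?f" "z \<notin> rf_poles ?g" if "\<not> Re z < 0" for z
      using st(1,2) sub[of P] sub[of P'] that by blast+
    have B: "z \<notin> rf_poles (?h - ?f)" "z \<notin> rf_poles (?h - ?g)" if "Re z < 0" for z
      using st(3,4) sub[of "F - P"] sub[of "F - P'"] that
      unfolding vector_minus_component by blast+
    have "z \<notin> rf_poles (?f - ?g)" for z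
    proof (cases "Re z < 0")
      case True
      then have "z \<notin> rf_poles ((?h - ?g) - (?h - ?f))" using rf_poles_diff[OF B(2,1)] by blast
      then show ?thesis by simp
    next
      case False
      then show ?thesis using rf_poles_diff[OF A] by blast
    qed
    then show "rf_poles (?f - ?g) = {}" by blast
    have "bounded (rf_poles ?f \<union> rf_poles ?g)"
      by (simp add: finite_imp_bounded finite_rf_poles)
    then obtain b where b: "\<And>z. z \<in> rf_poles ?f \<union> rf_poles ?g \<Longrightarrow> norm z \<le> b"
      unfolding bounded_iff by blast
    have ev: "\<forall>\<^sub>F z in at_infinity. rf_eval ?f z - rf_eval ?g z = rf_eval (?f - ?g) z"
      unfolding eventually_at_infinity
    proof (intro exI[of _ "b + 1"] allI impI)
      fix z :: complex assume "b + 1 \<le> norm z"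
      then have "z \<notin> rf_poles ?f" "z \<notin> rf_poles ?g" using b[of z] by auto
      then show "rf_eval ?f z - rf_eval ?g z = rf_eval (?f - ?g) z"
        by (simp add: rf_eval_diff)
    qed
    have "((\<lambda>z. rf_eval ?f z - rf_eval ?g z) \<longlongrightarrow> 0 - 0) at_infinity"
      by (intro tendsto_diff) (use assms in \<open>simp_all add: is_stable_part_def strictly_proper_def\<close>)
    then show "(rf_eval (?f - ?g) \<longlongrightarrow> 0) at_infinity"
      using ev by (simp add: tendsto_cong)
  qed
  then show ?thesis by (simp add: vec_eq_iff)
qed

lemma stable_part_eqI: "is_stable_part F P \<Longrightarrow> stable_part F = P"
  unfolding stable_part_def by (rule the_equality) (use is_stable_part_unique in blast)+

section \<open>Definiteness and the Loewner order\<close>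

definition pos_def :: "real^'n^'n \<Rightarrow> bool" where
  "pos_def X \<longleftrightarrow> transpose X = X \<and> (\<forall>v. v \<noteq> 0 \<longrightarrow> v \<bullet> (X *v v) > 0)"

definition loewner_le :: "real^'n^'n \<Rightarrow> real^'n^'n \<Rightarrow> bool" where
  "loewner_le X Y \<longleftrightarrow> transpose (Y - X) = Y - X \<and> (\<forall>v. v \<bullet> ((Y - X) *v v) \<ge> 0)"

definition herm_pos_def :: "complex^'n^'n \<Rightarrow> bool" where
  "herm_pos_def H \<longleftrightarrow> transpose (map_matrix cnj H) = H \<and>
     (\<forall>v. v \<noteq> 0 \<longrightarrow> Re (\<Sum>i\<in>UNIV. cnj (v $ i) * (H *v v) $ i) > 0)"

section \<open>Linear systems\<close>

definition hurwitz :: "real^'n^'n \<Rightarrow> bool" where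
  "hurwitz A \<longleftrightarrow>
     (\<forall>l v. v \<noteq> 0 \<and> map_matrix complex_of_real A *v v = l *s v \<longrightarrow> Re l < 0)"

text \<open>
  Every state can be reached from the origin in finite time.  Inputs are taken continuous;
  larger customary classes (piecewise continuous, finite energy) reach the same states.
\<close>

definition reachable :: "real^'n^'n \<Rightarrow> real^'m^'n \<Rightarrow> bool" where
  "reachable A B \<longleftrightarrow>
     (\<forall>x1. \<exists>T>0. \<exists>u x. continuous_on {0..T} u \<and> x 0 = 0 \<and> x T = x1 \<and>
        (\<forall>t\<in>{0..T}. (x has_vector_derivative A *v x t + B *v u t) (at t within {0..T})))"

text \<open>Only the zero initial state yields the zero output under the zero input.\<close>

definition observable :: "real^'n^'n \<Rightarrow> real^'n^'p \<Rightarrow> bool" where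
  "observable A C \<longleftrightarrow>
     (\<forall>x. (\<forall>t\<ge>0. (x has_vector_derivative A *v x t) (at t within {0..})) \<and>
          (\<forall>t\<ge>0. C *v x t = 0) \<longrightarrow> x 0 = 0)"

definition minimal_system :: "real^'n^'n \<Rightarrow> real^'m^'n \<Rightarrow> real^'n^'p \<Rightarrow> bool" where
  "minimal_system A B C \<longleftrightarrow> reachable A B \<and> observable A C"

definition rm_of_real :: "real^'n^'m \<Rightarrow> ratfun^'n^'m" where
  "rm_of_real X = map_matrix (\<lambda>a. rf_const (complex_of_real a)) X"

definition transfer_function ::
    "real^'n^'n \<Rightarrow> real^'m^'n \<Rightarrow> real^'n^'p \<Rightarrow> real^'m^'p \<Rightarrow> ratfun^'m^'p" where
  "transfer_function A B C D =
     rm_of_real C ** matrix_inv (mat rf_var - rm_of_real A) ** rm_of_real B + rm_of_real D"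

definition strictly_positive_real :: "ratfun^'m^'m \<Rightarrow> bool" where
  "strictly_positive_real G \<longleftrightarrow>
     (\<forall>w::real. herm_pos_def
        (rm_eval G (\<i> * complex_of_real w) + transpose (rm_eval G (- \<i> * complex_of_real w))))"

section \<open>Riccati equations\<close>

definition riccati_M ::
    "real^'n^'n \<Rightarrow> real^'m^'n \<Rightarrow> real^'n^'m \<Rightarrow> real^'m^'m \<Rightarrow> real^'n^'n \<Rightarrow> real^'n^'n" where
  "riccati_M A B C D Q =
     transpose A ** Q + Q ** A +
     transpose (C - transpose B ** Q) ** matrix_inv (D + transpose D) ** (C - transpose B ** Q)"

definition riccati_N ::
    "real^'n^'n \<Rightarrow> real^'m^'n \<Rightarrow> real^'n^'m \<Rightarrow> real^'m^'m \<Rightarrow> real^'n^'n \<Rightarrow> real^'n^'n" where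
  "riccati_N A B C D P =
     A ** P + P ** transpose A +
     (B - P ** transpose C) ** matrix_inv (D + transpose D) ** transpose (B - P ** transpose C)"

definition minimal_solution :: "(real^'n^'n \<Rightarrow> real^'n^'n) \<Rightarrow> real^'n^'n \<Rightarrow> bool" where
  "minimal_solution ric X \<longleftrightarrow> ric X = 0 \<and> pos_def X \<and>
     (\<forall>Y. transpose Y = Y \<and> ric Y = 0 \<longrightarrow> loewner_le X Y)"

end

theory Submission
  imports Defs
begin

text \<open>
  The formulas for \<open>G_B\<close> and \<open>G_C\<close> hold because a transfer function is a strictly proper term plus
  its constant feedthrough matrix.  The formula for \<open>G_sA\<close> is the substance.

  Write \<open>U = (s I - A)\<^sup>-\<^sup>1\<close>, \<open>V = (- s I - A)\<^sup>-\<^sup>1\<close>, \<open>T = M(-s)\<^sup>T = B\<^sup>T V\<^sup>T C\<^sub>M\<^sup>T + R\<^sup>1\<^sup>/\<^sup>2\<close> and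
  \<open>P = C\<^sub>M U B\<^sub>N\<close>.  The Riccati equation reads \<open>C\<^sub>M\<^sup>T C\<^sub>M = - A\<^sup>T Q - Q A = (- s I - A\<^sup>T) Q + Q (s I - A)\<close>,
  so multiplying by \<open>V\<^sup>T\<close> on the left and by \<open>U\<close> on the right splits the product
  \<open>V\<^sup>T C\<^sub>M\<^sup>T C\<^sub>M U\<close> into \<open>Q U + V\<^sup>T Q\<close>.  This yields \<open>T P = N\<^sub>\<infinity> + B\<^sup>T V\<^sup>T Q B\<^sub>N\<close>
  (\<open>lyapunov_factor_identity\<close>), that is,
  \<open>T\<^sup>-\<^sup>1 N\<^sub>\<infinity> = P - T\<^sup>-\<^sup>1 B\<^sup>T V\<^sup>T Q B\<^sub>N\<close>.
  The first summand has its poles among the eigenvalues of \<open>A\<close>, hence in the open left half-plane.  The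
  second one vanishes at infinity, where \<open>T\<close> tends to \<open>R\<^sup>1\<^sup>/\<^sup>2\<close>, and has to be shown free of poles in the
  open left half-plane.  For \<open>V\<close> this is again the stability of \<open>A\<close>.  For
  \<open>T\<^sup>-\<^sup>1\<close> it means that \<open>M(\<zeta>)\<close> is invertible if \<open>Re \<zeta> > 0\<close>; a vector in the kernel of \<open>M(\<zeta>)\<^sup>T\<close> yields
  an eigenvector for \<open>\<zeta>\<close> of the transpose of the closed loop matrix \<open>F = A - B R\<^sup>-\<^sup>1 (C - B\<^sup>T Q)\<close>
  (\<open>transfer_matrix_invertible\<close>).

  That \<open>F\<close> has no eigenvalue with positive real part follows from the minimality of \<open>Q\<close>
  (\<open>minimal_solution_closed_loop_eigenvalue\<close>).  Indeed \<open>Q + X\<close> solves the Riccati equation whenever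
  \<open>F\<^sup>T X + X F + X B R\<^sup>-\<^sup>1 B\<^sup>T X = 0\<close> with \<open>X\<close> symmetric, and out of an unstable eigenvector one constructs a solution \<open>X\<close> of
  rank one or two that is not positive semidefinite
  (\<open>riccati_solution_from_unstable_eigenvector\<close>), so that \<open>Q\<close> is not below \<open>Q + X\<close>.

  Absence of a pole at a point and strict properness are both treated as convergence of a rational
  matrix function along a filter, so that one set of limit rules, including one for the matrix
  inverse (\<open>rm_tendsto_matrix_inv\<close>), serves for both.
\<close>

section \<open>Matrix algebra\<close>

lemma matrix_add_rdistrib: "(A + B) ** C = A ** C + B ** C"
  by (vector matrix_matrix_mult_def sum.distrib distrib_right)

lemma matrix_diff_rdistrib: "((A::'a::ring_1^'n^'m) - B) ** C = A ** C - B ** C"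
  by (vector matrix_matrix_mult_def sum_subtractf left_diff_distrib)

lemma matrix_diff_ldistrib: "A ** ((B::'a::ring_1^'n^'m) - C) = A ** B - A ** C"
  by (vector matrix_matrix_mult_def sum_subtractf right_diff_distrib)

lemma matrix_minus_left: "(- (A::'a::ring_1^'n^'m)) ** B = - (A ** B)"
  by (vector matrix_matrix_mult_def sum_negf)

lemma matrix_minus_right: "A ** (- (B::'a::ring_1^'n^'m)) = - (A ** B)"
  by (vector matrix_matrix_mult_def sum_negf)

lemma transpose_add: "transpose (A + B) = transpose A + transpose B"
  by (simp add: transpose_def vec_eq_iff)

lemma transpose_diff: "transpose (A - B) = transpose A - transpose B"
  by (simp add: transpose_def vec_eq_iff)

lemma transpose_minus: "transpose (- A) = - transpose A"
  by (simp add: transpose_def vec_eq_iff)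

lemma mat_mult_component: "(mat c ** (X::'a::semiring_1^'n^'m)) $ i $ j = c * X $ i $ j"
  by (simp add: matrix_matrix_mult_def mat_def if_distrib if_distribR cong: if_cong)

lemma mult_mat_component: "((X::'a::comm_semiring_1^'n^'m) ** mat c) $ i $ j = c * X $ i $ j"
  by (simp add: matrix_matrix_mult_def mat_def if_distrib if_distribR mult.commute cong: if_cong)

lemma mat_mult_commute: "mat c ** (X::'a::comm_semiring_1^'n^'m) = X ** mat c"
  by (simp add: vec_eq_iff mat_mult_component mult_mat_component)

lemma matrix_mult_component_column: "(A ** B) $ i $ j = (A *v column j B) $ i"
  by (simp add: matrix_matrix_mult_def matrix_vector_mult_def column_def)

lemma column_matrix_mult: "column j (A ** B) = A *v column j B"
  by (simp add: vec_eq_iff matrix_matrix_mult_def matrix_vector_mult_def column_def)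

lemma matrix_inv_mult:
  assumes "invertible X"
  shows "X ** matrix_inv X = mat 1" "matrix_inv X ** X = mat 1"
proof -
  have "X ** matrix_inv X = mat 1 \<and> matrix_inv X ** X = mat 1"
    unfolding matrix_inv_def using assms unfolding invertible_def by (rule someI_ex)
  then show "X ** matrix_inv X = mat 1" "matrix_inv X ** X = mat 1" by auto
qed

lemma matrix_inv_eqI:
  fixes X :: "'a::field^'n^'n"
  assumes "X ** Y = mat 1"
  shows "invertible X" "matrix_inv X = Y"
proof -
  show i: "invertible X" using assms invertible_right_inverse by blast
  have "matrix_inv X = matrix_inv X ** (X ** Y)" by (simp add: assms)
  then show "matrix_inv X = Y" by (simp add: matrix_mul_assoc matrix_inv_mult[OF i])
qed

lemma invertible_if_ker_trivial:
  fixes X :: "'a::field^'n^'n"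
  assumes "\<And>v. X *v v = 0 \<Longrightarrow> v = 0"
  shows "invertible X"
  using assms invertible_left_inverse matrix_left_invertible_ker by blast

lemma pos_def_invertible: "pos_def X \<Longrightarrow> invertible X"
  by (rule invertible_if_ker_trivial) (force simp: pos_def_def)

lemma transpose_matrix_inv:
  fixes X :: "'a::field^'n^'n"
  assumes "invertible X"
  shows "transpose (matrix_inv X) = matrix_inv (transpose X)"
  by (metis assms matrix_inv_eqI(2) matrix_inv_mult(2) matrix_transpose_mul transpose_mat)

lemma pos_def_2:
  fixes P :: "real^2^2"
  assumes "P $ 1 $ 2 = P $ 2 $ 1" "P $ 1 $ 1 > 0" "(P $ 1 $ 2)\<^sup>2 < P $ 1 $ 1 * P $ 2 $ 2"
  shows "pos_def P"
proof -
  define x y z where xyz: "x = P $ 1 $ 1" "y = P $ 1 $ 2" "z = P $ 2 $ 2"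
  have "v \<bullet> (P *v v) > 0" if "v \<noteq> 0" for v
  proof -
    define s t where st: "s = v $ 1" "t = v $ 2"
    have ne: "s \<noteq> 0 \<or> t \<noteq> 0" using that by (auto simp: vec_eq_iff forall_2 st)
    have e: "v \<bullet> (P *v v) = x * s\<^sup>2 + 2 * y * s * t + z * t\<^sup>2"
      using assms(1) by (simp add: inner_vec_def matrix_vector_mult_def sum_2 st xyz 
        power2_eq_square algebra_simps)
    have "x * (x * s\<^sup>2 + 2 * y * s * t + z * t\<^sup>2) = (x * s + y * t)\<^sup>2 + (x * z - y\<^sup>2) * t\<^sup>2"
      by (simp add: power2_eq_square algebra_simps)
    also have "\<dots> > 0"
    proof (cases "t = 0")
      case True then show ?thesis using ne assms(2) xyz by simp
    next
      case False 
      then have "(x * z - y\<^sup>2) * t\<^sup>2 > 0" using assms(3) xyz by simp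
      then show ?thesis using zero_le_power2[of "x * s + y * t"] by linarith
    qed
    finally show ?thesis using e assms(2) xyz by (simp add: zero_less_mult_iff)
  qed
  moreover have "transpose P = P" using assms(1) by (simp add: vec_eq_iff forall_2 transpose_def)
  ultimately show ?thesis by (simp add: pos_def_def)
qed

section \<open>Solutions of the homogeneous Riccati equation\<close>

text \<open>
  The columns of \<open>W\<close> span an invariant subspace of \<open>F\<^sup>T\<close>.  With the ansatz \<open>X = - W Y W\<^sup>T\<close> the
  homogeneous Riccati equation for \<open>X\<close> becomes a quadratic equation for the small matrix \<open>Y\<close>, which
  is a Lyapunov equation for \<open>P = Y\<^sup>-\<^sup>1\<close>.
\<close>

lemma riccati_solution_from_invariant_subspace:
  fixes F :: "real^'n^'n" and E :: "real^'m^'n" and W :: "real^'k^'n" and K P :: "real^'k^'k"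
  assumes inv: "transpose F ** W = W ** K"
    and P: "pos_def P"
    and lyap: "P ** K + transpose K ** P = transpose (transpose E ** W) ** (transpose E ** W)"
    and W: "W \<noteq> 0"
  shows "\<exists>X. transpose X = X \<and> transpose F ** X + X ** F + X ** E ** transpose E ** X = 0 \<and>
    (\<exists>z. z \<bullet> (X *v z) < 0)"
proof -
  define Y where "Y = matrix_inv P"
  have PY: "P ** Y = mat 1" "Y ** P = mat 1"
    using matrix_inv_mult[OF pos_def_invertible[OF P]] by (simp_all add: Y_def)
  have sP: "transpose P = P" using P by (simp add: pos_def_def)
  have sY: "transpose Y = Y"
    using transpose_matrix_inv[OF pos_def_invertible[OF P]] by (simp add: Y_def sP)
  define X where "X = - (W ** Y ** transpose W)"
  have inv': "transpose W ** F = transpose K ** transpose W"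
    using arg_cong[OF inv, of transpose] by (simp add: matrix_transpose_mul)
  have "X ** E ** transpose E ** X
      = W ** Y ** (transpose (transpose E ** W) ** (transpose E ** W)) ** Y ** transpose W"
    by (simp add: X_def matrix_minus_left matrix_minus_right matrix_mul_assoc matrix_transpose_mul)
  also have "\<dots> = W ** (Y ** P) ** K ** Y ** transpose W + W ** Y ** transpose K ** (P ** Y) ** transpose W"
    unfolding lyap[symmetric] by (simp add: matrix_add_ldistrib matrix_add_rdistrib matrix_mul_assoc)
  also have "\<dots> = (W ** K) ** Y ** transpose W + W ** Y ** (transpose K ** transpose W)"
    by (simp add: PY matrix_mul_assoc)
  also have "\<dots> = - (transpose F ** X + X ** F)"
    by (simp add: inv[symmetric] inv'[symmetric] X_def matrix_minus_left matrix_minus_right matrix_mul_assoc)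
  finally have ric: "transpose F ** X + X ** F + X ** E ** transpose E ** X = 0" by simp
  have sX: "transpose X = X"
    by (simp add: X_def transpose_minus matrix_transpose_mul sY matrix_mul_assoc)
  obtain z where z: "transpose W *v z \<noteq> 0"
    using W matrix_eq[of "transpose W" 0] by (metis matrix_vector_mult_0 transpose_iff transpose_mat mat_0
      transpose_transpose times0_left matrix_transpose_mul)
  define h where "h = Y *v (transpose W *v z)"
  have Ph: "P *v h = transpose W *v z"
    unfolding h_def by (metis PY(1) matrix_vector_mul_assoc matrix_vector_mul_lid)
  then have "h \<noteq> 0" using z by auto
  then have "h \<bullet> (P *v h) > 0" using P by (simp add: pos_def_def)
  also have "h \<bullet> (P *v h) = z \<bullet> (W *v h)"
    unfolding Ph by (simp add: inner_commute[of h] dot_lmul_matrix)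
  also have "W *v h = - (X *v z)"
    unfolding h_def X_def 
    by (simp only: matrix_vector_mul_assoc) (simp add: vec_eq_iff matrix_vector_mult_def sum_negf matrix_mul_assoc)
  finally have "z \<bullet> (X *v z) < 0" by simp
  with ric sX show ?thesis by blast
qed

text \<open>
  Here \<open>u + \<i> v\<close> is an eigenvector of \<open>F\<^sup>T\<close> for the eigenvalue \<open>a + \<i> b\<close>.  If \<open>b \<noteq> 0\<close>, the pair \<open>u, v\<close>
  spans an invariant subspace.  In the basis of \<open>u + \<i> v\<close> and its conjugate, the solution of the
  Lyapunov equation on it is a Gram matrix with each entry divided by the sum of one eigenvalue and
  the conjugate of another, and it is positive definite by the Cauchy-Schwarz inequality and
  \<open>a\<^sup>2 < a\<^sup>2 + b\<^sup>2\<close>.  This last inequality fails for \<open>b = 0\<close>, where \<open>u\<close> and \<open>v\<close> may be dependent; one of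
  them is then an eigenvector that works alone.
\<close>

lemma riccati_solution_from_unstable_eigenvector:
  fixes F :: "real^'n^'n" and E :: "real^'m^'n" and u v :: "real^'n"
  assumes u: "transpose F *v u = a *\<^sub>R u - b *\<^sub>R v"
    and v: "transpose F *v v = b *\<^sub>R u + a *\<^sub>R v"
    and a: "a > 0"
    and E: "transpose E *v u \<noteq> 0 \<or> transpose E *v v \<noteq> 0"
  shows "\<exists>X. transpose X = X \<and> transpose F ** X + X ** F + X ** E ** transpose E ** X = 0 \<and>
    (\<exists>z. z \<bullet> (X *v z) < 0)"
proof (cases "b = 0")
  case True
  obtain x where x: "transpose F *v x = a *\<^sub>R x" "transpose E *v x \<noteq> 0"
    using u v E True by auto
  define W :: "real^1^'n" where "W = (\<chi> i j. x $ i)"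
  have c: "column 1 W = x" by (simp add: W_def column_def)
  define s where "s = norm (transpose E *v x)"
  have s: "s > 0" using x(2) unfolding s_def by simp
  show ?thesis
  proof (rule riccati_solution_from_invariant_subspace)
    show "transpose F ** W = W ** mat a"
      unfolding vec_eq_iff forall_1 matrix_mult_component_column[of "transpose F"] c x mult_mat_component
      by (simp add: W_def)
    have "x \<noteq> 0" using x(2) by auto
    then show "W \<noteq> 0" by (auto simp: W_def vec_eq_iff)
    show "pos_def (mat (s\<^sup>2 / (2 * a)) :: real^1^1)"
      unfolding pos_def_def transpose_mat using a s
      by (auto simp: inner_vec_def matrix_vector_mult_def mat_def vec_eq_iff zero_less_mult_iff
          zero_less_divide_iff mult_less_0_iff)
    show "mat (s\<^sup>2 / (2 * a)) ** mat a + transpose (mat a) ** mat (s\<^sup>2 / (2 * a)) =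
      transpose (transpose E ** W) ** (transpose E ** W)"
      unfolding matrix_mult_transpose_dot_column column_matrix_mult
      using a unfolding transpose_mat vec_eq_iff forall_1 vector_add_component mat_mult_component c
      by (simp add: mat_def c s_def power2_norm_eq_inner del: transpose_matrix_vector)
  qed
next
  case False
  define e f where ef: "e = transpose E *v u" "f = transpose E *v v"
  define p q r where pqr: "p = e \<bullet> e" "q = e \<bullet> f" "r = f \<bullet> f"
  have pr: "p + r > 0" using E unfolding pqr ef[symmetric]
    by (metis add.commute add_nonneg_pos add_pos_nonneg inner_ge_zero inner_gt_zero_iff)
  have cs: "q\<^sup>2 \<le> p * r" unfolding pqr by (rule Cauchy_Schwarz_ineq)
  define n where "n = a\<^sup>2 + b\<^sup>2"
  have n: "n > a\<^sup>2" "n > 0" using False a by (auto simp: n_def add_pos_nonneg)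
  \<comment> \<open>The symmetric matrix with rows \<open>(x, y)\<close> and \<open>(y, z)\<close> solves the Lyapunov equation whose right-hand side is the Gram matrix of \<open>e\<close> and \<open>f\<close>.\<close>
  define y where "y = (2 * a * q - b * (p - r)) / (4 * n)"
  define x z where xz: "x = (p / 2 + b * y) / a" "z = (r / 2 - b * y) / a"
  have ax: "a * x = p / 2 + b * y" and az: "a * z = r / 2 - b * y" using a by (auto simp: xz)
  have ny: "4 * n * y = 2 * a * q - b * (p - r)" using n by (simp add: y_def)
  have l2: "b * (x - z) + 2 * a * y = q"
  proof -
    have "2 * a * (b * (x - z) + 2 * a * y) = 2 * b * (a * x - a * z) + 4 * a\<^sup>2 * y"
      by (simp add: algebra_simps power2_eq_square)
    also have "\<dots> = b * (p - r) + 4 * n * y"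
      unfolding ax az n_def by (simp add: algebra_simps power2_eq_square)
    also have "\<dots> = 2 * a * q" unfolding ny by simp
    finally show ?thesis using a by simp
  qed
  have sum: "x + z = (p + r) / (2 * a)" using ax az a by (simp add: field_simps)
  have diff: "2 * a * (x - z) - 4 * b * y = p - r" using ax az by (simp add: algebra_simps)
  \<comment> \<open>In complex terms, \<open>x - z + 2 \<i> y\<close> times \<open>2 (a + \<i> b)\<close> equals \<open>p - r + 2 \<i> q\<close>; compare squared moduli.\<close>
  have mod: "4 * n * ((x - z)\<^sup>2 + 4 * y\<^sup>2) = (p - r)\<^sup>2 + 4 * q\<^sup>2"
    unfolding n_def l2[symmetric] diff[symmetric] by algebra
  have "(p - r)\<^sup>2 + 4 * q\<^sup>2 \<le> (p + r)\<^sup>2" using cs by (simp add: power2_eq_square algebra_simps)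
  also have "(p + r)\<^sup>2 = 4 * a\<^sup>2 * (x + z)\<^sup>2" unfolding sum using a by (simp add: power2_eq_square field_simps)
  also have "\<dots> < 4 * n * (x + z)\<^sup>2" 
    using n pr sum a by (intro mult_strict_right_mono) auto
  finally have "(x - z)\<^sup>2 + 4 * y\<^sup>2 < (x + z)\<^sup>2" using n(2) unfolding mod[symmetric] by simp
  then have det: "y\<^sup>2 < x * z" by (simp add: power2_eq_square algebra_simps)
  have "x * z > 0" using det zero_le_power2[of y] by linarith
  moreover have "x + z > 0" using sum pr a by simp
  ultimately have x: "x > 0" by (auto simp: zero_less_mult_iff)
  define W :: "real^2^'n" where "W = (\<chi> i j. if j = 1 then u $ i else v $ i)"
  have c: "column 1 W = u" "column 2 W = v" by (simp_all add: W_def column_def)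
  define K :: "real^2^2" where "K = vector [vector [a, b], vector [- b, a]]"
  define P :: "real^2^2" where "P = vector [vector [x, y], vector [y, z]]"
  show ?thesis
  proof (rule riccati_solution_from_invariant_subspace)
    show "transpose F ** W = W ** K"
      unfolding vec_eq_iff forall_2 matrix_mult_component_column[of "transpose F"] c u v
      by (simp add: matrix_matrix_mult_def sum_2 W_def K_def)
    have "u \<noteq> 0 \<or> v \<noteq> 0" using E by auto
    then show "W \<noteq> 0" unfolding W_def vec_eq_iff forall_2 by auto
    show "pos_def P" by (rule pos_def_2) (use x det in \<open>simp_all add: P_def\<close>)
    have tK: "transpose K = vector [vector [a, - b], vector [b, a]]"
      by (simp add: K_def vec_eq_iff forall_2 transpose_def)
    show "P ** K + transpose K ** P = transpose (transpose E ** W) ** (transpose E ** W)"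
      unfolding matrix_mult_transpose_dot_column column_matrix_mult
      unfolding vec_eq_iff forall_2 tK
      using ax az l2 
      by (simp add: matrix_matrix_mult_def sum_2 P_def K_def c ef[symmetric] pqr[symmetric]
         inner_commute[of f e] algebra_simps del: transpose_matrix_vector)
  qed
qed

section \<open>Closed loop eigenvalues of the minimal solution\<close>

abbreviation cmat :: "real^'n^'m \<Rightarrow> complex^'n^'m" where
  "cmat \<equiv> map_matrix complex_of_real"

lemma cmat_diff: "cmat (X - Y) = cmat X - cmat Y"
  by (simp add: vec_eq_iff)

lemma cmat_mult: "cmat (X ** Y) = cmat X ** cmat Y"
  by (simp add: vec_eq_iff matrix_matrix_mult_def)

lemma cmat_transpose: "cmat (transpose X) = transpose (cmat X)"
  by (simp add: vec_eq_iff transpose_def)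

lemma cmat_mat_1: "cmat (mat 1) = mat 1"
  by (simp add: vec_eq_iff mat_def)

lemma Re_cmat_mult: "Re ((cmat X *v w) $ i) = (X *v (\<chi> j. Re (w $ j))) $ i"
  and Im_cmat_mult: "Im ((cmat X *v w) $ i) = (X *v (\<chi> j. Im (w $ j))) $ i"
  by (simp_all add: matrix_vector_mult_def)

lemma mat_mult_vector: "mat c *v (x::'a::comm_semiring_1^'n) = c *s x"
  by (simp add: vec_eq_iff matrix_vector_mult_def mat_def if_distrib if_distribR cong: if_cong)

lemma hurwitz_resolvent:
  assumes "hurwitz A" "Re z \<ge> 0"
  shows "invertible (mat z - cmat A)"
proof (rule invertible_if_ker_trivial)
  fix v assume "(mat z - cmat A) *v v = 0"
  then have "cmat A *v v = z *s v" by (simp add: matrix_vector_mult_diff_rdistrib mat_mult_vector)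
  then show "v = 0" using assms unfolding hurwitz_def by force
qed

lemma hurwitz_transpose_eigenvalue:
  assumes "hurwitz A" "cmat (transpose A) *v w = z *s w" "w \<noteq> 0"
  shows "Re z < 0"
proof (rule ccontr)
  assume "\<not> Re z < 0"
  then have "invertible (mat z - cmat A)" using hurwitz_resolvent assms by force
  then have "invertible (transpose (mat z - cmat A))" by (simp add: invertible_det_nz)
  moreover have "transpose (mat z - cmat A) *v w = 0"
    using assms(2) by (simp only: transpose_diff transpose_mat matrix_vector_mult_diff_rdistrib
      mat_mult_vector cmat_transpose) simp
  ultimately show False using assms(3) 
    by (metis matrix_inv_mult(2) matrix_vector_mul_assoc matrix_vector_mul_lid matrix_vector_mult_0_right)
qed

text \<open>
  The part of the Riccati expression that is linear in the increment \<open>X\<close> is a Lyapunov expression of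
  the closed loop matrix \<open>F\<close>.
\<close>

lemma riccati_M_add:
  assumes "transpose Ri = Ri" "matrix_inv (D + transpose D) = Ri ** Ri" "transpose X = X"
    and F: "F = A - B ** Ri ** (Ri ** (C - transpose B ** Q))"
  shows "riccati_M A B C D (Q + X) = riccati_M A B C D Q +
    (transpose F ** X + X ** F + X ** (B ** Ri) ** transpose (B ** Ri) ** X)"
proof -
  define S where "S = C - transpose B ** Q"
  have S: "C - transpose B ** (Q + X) = S - transpose B ** X"
    by (simp add: S_def matrix_add_ldistrib)
  show ?thesis
    unfolding riccati_M_def S F S_def[symmetric] assms(2)
    by (simp add: assms(1,3) matrix_transpose_mul transpose_diff matrix_add_ldistrib matrix_add_rdistrib
      matrix_diff_ldistrib matrix_diff_rdistrib matrix_mul_assoc)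
qed

text \<open>
  An unstable eigenvector \<open>w\<close> of \<open>F\<^sup>T\<close> is not annihilated by \<open>E\<^sup>T\<close>, since it would otherwise be one of
  \<open>A\<^sup>T\<close>.  Hence it produces a symmetric solution \<open>Q + X\<close> that does not dominate \<open>Q\<close>.
\<close>

lemma minimal_solution_closed_loop_eigenvalue:
  fixes A :: "real^'n^'n" and B :: "real^'m^'n" and w :: "complex^'n"
  assumes hA: "hurwitz A" and Q: "minimal_solution (riccati_M A B C D) Q"
    and Ri: "transpose Ri = Ri" "matrix_inv (D + transpose D) = Ri ** Ri"
    and F: "F = A - B ** Ri ** (Ri ** (C - transpose B ** Q))"
    and w: "cmat (transpose F) *v w = z *s w" "w \<noteq> 0"
  shows "Re z \<le> 0"
proof (rule ccontr)
  assume "\<not> Re z \<le> 0"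
  then have z: "Re z > 0" by simp
  define E where "E = B ** Ri"
  define u v where "u = (\<chi> j. Re (w $ j))" and "v = (\<chi> j. Im (w $ j))"
  have comp: "(cmat (transpose F) *v w) $ i = z * w $ i" for i unfolding w(1) by simp
  have u: "transpose F *v u = Re z *\<^sub>R u - Im z *\<^sub>R v"
    using arg_cong[OF comp, of Re] unfolding vec_eq_iff Re_cmat_mult by (simp add: u_def v_def)
  have v: "transpose F *v v = Im z *\<^sub>R u + Re z *\<^sub>R v"
    using arg_cong[OF comp, of Im] unfolding vec_eq_iff Im_cmat_mult by (simp add: u_def v_def)
  have E: "transpose E *v u \<noteq> 0 \<or> transpose E *v v \<noteq> 0"
  proof (rule ccontr)
    assume "\<not> ?thesis"
    then have "Re ((cmat (transpose E) *v w) $ i) = 0" "Im ((cmat (transpose E) *v w) $ i) = 0" for i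
      unfolding Re_cmat_mult Im_cmat_mult u_def v_def by (simp_all add: vec_eq_iff)
    then have Ew: "cmat (transpose E) *v w = 0" by (simp add: vec_eq_iff complex_eq_iff)
    have "cmat (transpose F) *v w = cmat (transpose A) *v w - cmat (transpose (Ri ** (C - transpose B ** Q))) *v (cmat (transpose E) *v w)"
      unfolding F E_def[symmetric] transpose_diff matrix_transpose_mul[of E] cmat_diff cmat_mult
        matrix_vector_mult_diff_rdistrib matrix_vector_mul_assoc ..
    then have "cmat (transpose A) *v w = z *s w" unfolding Ew w(1) by simp
    then show False using hurwitz_transpose_eigenvalue[OF hA _ w(2)] z by force
  qed
  obtain X y where X: "transpose X = X" 
    "transpose F ** X + X ** F + X ** E ** transpose E ** X = 0" "y \<bullet> (X *v y) < 0"
    using riccati_solution_from_unstable_eigenvector[OF u v z E] by blast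
  have "transpose Q = Q" "riccati_M A B C D Q = 0" using Q by (auto simp: minimal_solution_def pos_def_def)
  moreover have "riccati_M A B C D (Q + X) = 0"
    using riccati_M_add[OF Ri X(1) F] X(2) calculation by (simp add: E_def)
  ultimately have "loewner_le Q (Q + X)"
    using Q X(1) unfolding minimal_solution_def by (simp add: transpose_add)
  then show False using X(3) by (auto simp: loewner_le_def not_less[symmetric])
qed

text \<open>
  The closed loop matrix \<open>F\<close> is the state matrix of the inverse system.  If \<open>y\<close> is in the
  kernel of the transposed transfer matrix at \<open>z\<close>, then the state \<open>w\<close> that it generates in the dual
  system satisfies \<open>E\<^sup>T w = - y\<close> with \<open>E = B Rh\<^sup>-\<^sup>1\<close>; this turns the resolvent equation for \<open>w\<close> into
  \<open>F\<^sup>T w = z w\<close>.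
\<close>

lemma transfer_matrix_invertible:
  fixes A :: "real^'n^'n" and B :: "real^'m^'n" and H :: "real^'n^'m" and Rh Ri :: "real^'m^'m"
  assumes res: "invertible (mat z - cmat A)"
    and Ri: "Rh ** Ri = mat 1"
    and F: "F = A - B ** Ri ** H"
    and ev: "\<And>w. cmat (transpose F) *v w = z *s w \<Longrightarrow> w = 0"
  shows "invertible (cmat H ** matrix_inv (mat z - cmat A) ** cmat B + cmat Rh)"
proof -
  let ?M = "cmat H ** matrix_inv (mat z - cmat A) ** cmat B + cmat Rh"
  have "invertible (transpose ?M)"
  proof (rule invertible_if_ker_trivial)
    fix y assume y: "transpose ?M *v y = 0"
    let ?T = "transpose (matrix_inv (mat z - cmat A))"
    define w where "w = ?T *v (transpose (cmat H) *v y)"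
    have y': "transpose (cmat B) *v w = - (transpose (cmat Rh) *v y)"
      using y unfolding transpose_add matrix_transpose_mul matrix_vector_mult_add_rdistrib w_def
      by (simp only: matrix_vector_mul_assoc matrix_mul_assoc add_eq_0_iff2)
    have RR: "transpose (cmat Ri) ** transpose (cmat Rh) = mat 1"
      unfolding matrix_transpose_mul[symmetric] cmat_mult[symmetric] Ri cmat_mat_1 by simp
    have Ew: "transpose (cmat (B ** Ri)) *v w = - y"
    proof -
      have "transpose (cmat (B ** Ri)) *v w = transpose (cmat Ri) *v (transpose (cmat B) *v w)"
        unfolding cmat_mult matrix_transpose_mul matrix_vector_mul_assoc ..
      also have "\<dots> = - ((transpose (cmat Ri) ** transpose (cmat Rh)) *v y)"
        unfolding y' matrix_vector_mul_assoc[symmetric]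
        using matrix_vector_mult_diff_distrib[of "transpose (cmat Ri)" 0] by (simp only: diff_0 matrix_vector_mult_0_right)
      finally show ?thesis unfolding RR by simp
    qed
    have "transpose (mat z - cmat A) ** ?T = mat 1"
      unfolding matrix_transpose_mul[symmetric] matrix_inv_mult[OF res] by simp
    then have "transpose (mat z - cmat A) *v w = transpose (cmat H) *v y"
      unfolding w_def matrix_vector_mul_assoc matrix_mul_assoc by simp
    then have Aw: "z *s w - transpose (cmat A) *v w = transpose (cmat H) *v y"
      unfolding transpose_diff transpose_mat matrix_vector_mult_diff_rdistrib mat_mult_vector .
    have "cmat (transpose F) *v w = 
      transpose (cmat A) *v w - transpose (cmat H) *v (transpose (cmat (B ** Ri)) *v w)"
      unfolding F cmat_transpose transpose_diff matrix_transpose_mul[of "cmat (B ** Ri)"] cmat_diff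
        cmat_mult[of "B ** Ri"] matrix_vector_mult_diff_rdistrib matrix_vector_mul_assoc ..
    also have "\<dots> = transpose (cmat A) *v w + transpose (cmat H) *v y"
      unfolding Ew using matrix_vector_mult_diff_distrib[of "transpose (cmat H)" 0 y] 
      by (simp only: diff_0 matrix_vector_mult_0_right diff_minus_eq_add)
    also have "\<dots> = z *s w" unfolding Aw[symmetric] by simp
    finally have "w = 0" by (rule ev)
    then show "y = 0" using Ew by simp
  qed
  then show ?thesis by (simp add: invertible_det_nz)
qed

section \<open>Limits of rational matrix functions\<close>

text \<open>
  Along such a filter the poles of finitely many rational functions can be ignored, so that
  evaluation behaves like a ring homomorphism.  The punctured neighbourhoods of a point and the
  neighbourhoods of infinity are the instances of interest.
\<close>

definition generic_filter :: "complex filter \<Rightarrow> bool" where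
  "generic_filter F \<longleftrightarrow> F \<noteq> bot \<and> (\<forall>S. finite S \<longrightarrow> (\<forall>\<^sub>F z in F. z \<notin> S))"

lemma generic_filter_at: "generic_filter (at a)"
  unfolding generic_filter_def
proof (intro conjI allI impI)
  fix S :: "complex set" assume "finite S"
  then have "open (- (S - {a}))" by (intro open_Compl finite_imp_closed) simp
  then have "\<forall>\<^sub>F z in at a. z \<in> - (S - {a}) - {a}"
    by (intro eventually_at_in_open) auto
  then show "\<forall>\<^sub>F z in at a. z \<notin> S" by (rule eventually_mono) auto
qed simp

lemma generic_filter_at_infinity: "generic_filter at_infinity"
  unfolding generic_filter_def
proof (intro conjI allI impI)
  fix S :: "complex set" assume "finite S"
  then obtain b where b: "\<And>z. z \<in> S \<Longrightarrow> norm z \<le> b"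
    using finite_imp_bounded bounded_iff by metis
  show "\<forall>\<^sub>F z in at_infinity. z \<notin> S"
    unfolding eventually_at_infinity using b by (intro exI[of _ "b + 1"]) force
qed (rule trivial_limit_at_infinity)

lemma rf_eval_const [simp]: "rf_eval (rf_const c) z = c"
  by (simp add: rf_const_def rf_eval_def)

lemma rf_eval_var [simp]: "rf_eval rf_var z = z"
  by (simp add: rf_var_def rf_eval_def)

lemma rf_const_0 [simp]: "rf_const 0 = 0" and rf_const_1 [simp]: "rf_const 1 = 1"
  by (simp_all add: rf_const_def flip: one_pCons)

lemma rf_const_add: "rf_const (a + b) = rf_const a + rf_const b"
  and rf_const_diff: "rf_const (a - b) = rf_const a - rf_const b"
  and rf_const_mult: "rf_const (a * b) = rf_const a * rf_const b"
  by (simp_all add: rf_const_def flip: to_fract_add to_fract_diff to_fract_mult)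

lemma rf_const_sum: "rf_const (\<Sum>i\<in>S. f i) = (\<Sum>i\<in>S. rf_const (f i))"
  by (induction S rule: infinite_finite_induct) (simp_all add: rf_const_add)

lemma rf_const_of_int: "of_int k = rf_const (of_int k)"
  by (induction k rule: int_induct[of _ 0]) (simp_all add: rf_const_add rf_const_diff)

lemma Fract_cases_nonpole:
  assumes "z \<notin> rf_poles f" 
  obtains p q where "f = Fract p q" "q \<noteq> 0" "poly q z \<noteq> 0" 
  using assms unfolding rf_pole_iff by force

lemma rf_eval_add:
  assumes "z \<notin> rf_poles f" "z \<notin> rf_poles g"
  shows "rf_eval (f + g) z = rf_eval f z + rf_eval g z"
proof -
  obtain p q where f: "f = Fract p q" "q \<noteq> 0" "poly q z \<noteq> 0" by (rule Fract_cases_nonpole[OF assms(1)])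
  obtain p' q' where g: "g = Fract p' q'" "q' \<noteq> 0" "poly q' z \<noteq> 0" by (rule Fract_cases_nonpole[OF assms(2)])
  have d: "f + g = Fract (p * q' + p' * q) (q * q')" using f g by simp
  have n: "poly (q * q') z \<noteq> 0" using f g by simp
  show ?thesis unfolding d rf_eval_Fract[OF n] using f g by (simp add: rf_eval_Fract add_frac_eq)
qed

lemma rf_eval_mult:
  assumes "z \<notin> rf_poles f" "z \<notin> rf_poles g"
  shows "rf_eval (f * g) z = rf_eval f z * rf_eval g z"
proof -
  obtain p q where f: "f = Fract p q" "q \<noteq> 0" "poly q z \<noteq> 0" by (rule Fract_cases_nonpole[OF assms(1)])
  obtain p' q' where g: "g = Fract p' q'" "q' \<noteq> 0" "poly q' z \<noteq> 0" by (rule Fract_cases_nonpole[OF assms(2)])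
  show ?thesis using f g by (simp add: rf_eval_Fract)
qed

lemma eventually_not_pole:
  assumes "generic_filter F"
  shows "\<forall>\<^sub>F z in F. z \<notin> rf_poles f"
  using assms finite_rf_poles unfolding generic_filter_def by blast

context
  fixes F :: "complex filter"
  assumes F: "generic_filter F"
begin

lemma rf_tendsto_add:
  assumes "(rf_eval f \<longlongrightarrow> a) F" "(rf_eval g \<longlongrightarrow> b) F"
  shows "(rf_eval (f + g) \<longlongrightarrow> a + b) F"
  by (rule Lim_transform_eventually[OF tendsto_add[OF assms]])
     (use eventually_conj[OF eventually_not_pole[OF F, of f] eventually_not_pole[OF F, of g]]
       in \<open>auto elim!: eventually_mono simp: rf_eval_add\<close>)

lemma rf_tendsto_diff:
  assumes "(rf_eval f \<longlongrightarrow> a) F" "(rf_eval g \<longlongrightarrow> b) F"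
  shows "(rf_eval (f - g) \<longlongrightarrow> a - b) F"
  by (rule Lim_transform_eventually[OF tendsto_diff[OF assms]])
     (use eventually_conj[OF eventually_not_pole[OF F, of f] eventually_not_pole[OF F, of g]]
       in \<open>auto elim!: eventually_mono simp: rf_eval_diff\<close>)

lemma rf_tendsto_mult:
  assumes "(rf_eval f \<longlongrightarrow> a) F" "(rf_eval g \<longlongrightarrow> b) F"
  shows "(rf_eval (f * g) \<longlongrightarrow> a * b) F"
  by (rule Lim_transform_eventually[OF tendsto_mult[OF assms]])
     (use eventually_conj[OF eventually_not_pole[OF F, of f] eventually_not_pole[OF F, of g]]
       in \<open>auto elim!: eventually_mono simp: rf_eval_mult\<close>)

lemma rf_tendsto_const: "(rf_eval (rf_const c) \<longlongrightarrow> c) F"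
  unfolding rf_eval_const[abs_def] by (rule tendsto_const)

lemma rf_tendsto_0: "(rf_eval 0 \<longlongrightarrow> 0) F" and rf_tendsto_1: "(rf_eval 1 \<longlongrightarrow> 1) F"
  using rf_tendsto_const[of 0] rf_tendsto_const[of 1] by simp_all

lemma rf_tendsto_unique:
  assumes "(rf_eval f \<longlongrightarrow> a) F" "(rf_eval f \<longlongrightarrow> b) F"
  shows "a = b"
  using assms F tendsto_unique unfolding generic_filter_def by blast

lemma rf_tendsto_inverse:
  assumes f: "(rf_eval f \<longlongrightarrow> a) F" and a: "a \<noteq> 0"
  shows "f \<noteq> 0" "(rf_eval (inverse f) \<longlongrightarrow> inverse a) F"
proof -
  show f0: "f \<noteq> 0" using rf_tendsto_unique[OF f] rf_tendsto_0 a by blast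
  have *: "inverse (rf_eval f z) = rf_eval (inverse f) z"
    if "z \<notin> rf_poles f" "z \<notin> rf_poles (inverse f)" for z
    using rf_eval_mult[OF that] f0 rf_eval_const[of 1 z] by (metis inverse_unique right_inverse rf_const_1)
  show "(rf_eval (inverse f) \<longlongrightarrow> inverse a) F"
    by (rule Lim_transform_eventually[OF tendsto_inverse[OF f a]])
       (use eventually_conj[OF eventually_not_pole[OF F, of f] eventually_not_pole[OF F, of "inverse f"]]
         in \<open>auto elim!: eventually_mono simp: *\<close>)
qed

lemma rf_tendsto_sum:
  assumes "\<And>i. i \<in> S \<Longrightarrow> (rf_eval (f i) \<longlongrightarrow> a i) F"
  shows "(rf_eval (\<Sum>i\<in>S. f i) \<longlongrightarrow> (\<Sum>i\<in>S. a i)) F"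
  using assms by (induction S rule: infinite_finite_induct) (simp_all add: rf_tendsto_0 rf_tendsto_add)

lemma rf_tendsto_prod:
  assumes "\<And>i. i \<in> S \<Longrightarrow> (rf_eval (f i) \<longlongrightarrow> a i) F"
  shows "(rf_eval (\<Prod>i\<in>S. f i) \<longlongrightarrow> (\<Prod>i\<in>S. a i)) F"
  using assms by (induction S rule: infinite_finite_induct) (simp_all add: rf_tendsto_1 rf_tendsto_mult)

lemma rm_tendsto_iff:
  "(rm_eval X \<longlongrightarrow> L) F \<longleftrightarrow> (\<forall>i j. (rf_eval (X $ i $ j) \<longlongrightarrow> L $ i $ j) F)"
proof
  assume *: "(rm_eval X \<longlongrightarrow> L) F"
  show "\<forall>i j. (rf_eval (X $ i $ j) \<longlongrightarrow> L $ i $ j) F"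
    using tendsto_vec_nth[OF tendsto_vec_nth[OF *]] by (simp add: rm_eval_def)
next
  assume "\<forall>i j. (rf_eval (X $ i $ j) \<longlongrightarrow> L $ i $ j) F"
  then show "(rm_eval X \<longlongrightarrow> L) F"
    by (intro vec_tendstoI) (simp add: rm_eval_def)
qed

lemma rm_tendsto_add:
  "(rm_eval X \<longlongrightarrow> K) F \<Longrightarrow> (rm_eval Y \<longlongrightarrow> L) F \<Longrightarrow> (rm_eval (X + Y) \<longlongrightarrow> K + L) F"
  unfolding rm_tendsto_iff by (simp add: rf_tendsto_add)

lemma rm_tendsto_diff:
  "(rm_eval X \<longlongrightarrow> K) F \<Longrightarrow> (rm_eval Y \<longlongrightarrow> L) F \<Longrightarrow> (rm_eval (X - Y) \<longlongrightarrow> K - L) F"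
  unfolding rm_tendsto_iff by (simp add: rf_tendsto_diff)

lemma rm_tendsto_mult:
  "(rm_eval X \<longlongrightarrow> K) F \<Longrightarrow> (rm_eval Y \<longlongrightarrow> L) F \<Longrightarrow> (rm_eval (X ** Y) \<longlongrightarrow> K ** L) F"
  unfolding rm_tendsto_iff by (simp add: matrix_matrix_mult_def rf_tendsto_sum rf_tendsto_mult)

lemma rm_tendsto_transpose:
  "(rm_eval X \<longlongrightarrow> K) F \<Longrightarrow> (rm_eval (transpose X) \<longlongrightarrow> transpose K) F"
  unfolding rm_tendsto_iff by (simp add: transpose_def)

lemma rm_tendsto_mat:
  "(rf_eval f \<longlongrightarrow> c) F \<Longrightarrow> (rm_eval (mat f) \<longlongrightarrow> mat c) F"
  unfolding rm_tendsto_iff by (simp add: mat_def rf_tendsto_0)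

lemma rm_tendsto_of_real: "(rm_eval (rm_of_real X) \<longlongrightarrow> map_matrix of_real X) F"
  unfolding rm_tendsto_iff by (simp add: rm_of_real_def rf_tendsto_const)

lemma rf_tendsto_det:
  assumes "(rm_eval X \<longlongrightarrow> L) F"
  shows "(rf_eval (det X) \<longlongrightarrow> det L) F"
  using assms unfolding det_def rm_tendsto_iff
  by (auto intro!: rf_tendsto_sum rf_tendsto_mult rf_tendsto_prod simp: rf_const_of_int rf_tendsto_const)

text \<open>
  By Cramer's rule the entries of the inverse are quotients of determinants, and these converge
  together with the entries of the matrix.
\<close>

lemma rm_tendsto_matrix_inv:
  fixes X :: "ratfun^'n^'n"
  assumes X: "(rm_eval X \<longlongrightarrow> L) F" and L: "invertible L"
  shows "invertible X" "(rm_eval (matrix_inv X) \<longlongrightarrow> matrix_inv L) F"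
proof -
  have det: "(rf_eval (det X) \<longlongrightarrow> det L) F" by (rule rf_tendsto_det[OF X])
  have dL: "det L \<noteq> 0" using L invertible_det_nz by blast
  have dX: "det X \<noteq> 0" by (rule rf_tendsto_inverse(1)[OF det dL])
  then show iX: "invertible X" using invertible_det_nz by blast
  have cr: "matrix_inv Y $ i $ j = det (\<chi> k l. if l = i then mat 1 $ k $ j else Y $ k $ l) * inverse (det Y)"
    if "det Y \<noteq> 0" "invertible Y" for Y :: "'a::field^'n^'n" and i j
  proof -
    have "Y *v column j (matrix_inv Y) = column j (mat 1)"
      unfolding column_matrix_mult[symmetric] matrix_inv_mult[OF that(2)] ..
    then have "column j (matrix_inv Y) $ i = 
      det (\<chi> k l. if l = i then column j (mat 1) $ k else Y $ k $ l) / det Y"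
      unfolding cramer[OF that(1)] by simp
    then show ?thesis unfolding column_def vec_lambda_beta by (simp add: divide_inverse)
  qed
  show "(rm_eval (matrix_inv X) \<longlongrightarrow> matrix_inv L) F"
    unfolding rm_tendsto_iff cr[OF dX iX] cr[OF dL L]
  proof (intro allI rf_tendsto_mult rf_tendsto_inverse(2)[OF det dL] rf_tendsto_det)
    fix i j
    show "(rm_eval (\<chi> k l. if l = i then mat 1 $ k $ j else X $ k $ l) \<longlongrightarrow>
       (\<chi> k l. if l = i then mat 1 $ k $ j else L $ k $ l)) F"
      using X unfolding rm_tendsto_iff by (auto simp: mat_def rf_tendsto_0 rf_tendsto_1)
  qed
qed

text \<open>
  The factorisation \<open>f I - A = f (I - f\<^sup>-\<^sup>1 A)\<close> reduces this to the inverse of a matrix that tends to the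
  identity.
\<close>

lemma resolvent_tendsto_0:
  fixes A :: "ratfun^'n^'n"
  assumes A: "(rm_eval A \<longlongrightarrow> L) F" and "f \<noteq> 0" "(rf_eval (inverse f) \<longlongrightarrow> 0) F"
  shows "invertible (mat f - A)" "(rm_eval (matrix_inv (mat f - A)) \<longlongrightarrow> 0) F"
proof -
  define X where "X = mat 1 - mat (inverse f) ** A"
  have "(rm_eval X \<longlongrightarrow> mat 1 - mat 0 ** L) F"
    unfolding X_def by (intro rm_tendsto_diff rm_tendsto_mult rm_tendsto_mat A assms rf_tendsto_1)
  then have X: "(rm_eval X \<longlongrightarrow> mat 1) F" by simp
  have i1: "invertible (mat 1 :: complex^'n^'n)" by (simp add: invertible_det_nz)
  note inv = rm_tendsto_matrix_inv[OF X i1]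
  have m1: "matrix_inv (mat 1) = (mat 1 :: complex^'n^'n)" by (rule matrix_inv_eqI) simp
  have mm: "mat f ** mat (inverse f) = (mat 1 :: ratfun^'n^'n)"
    using assms(2) by (simp add: vec_eq_iff mat_mult_component) (simp add: mat_def)
  have fX: "mat f - A = mat f ** X"
    unfolding X_def by (simp add: matrix_diff_ldistrib matrix_mul_assoc mm)
  have "(mat f - A) ** (matrix_inv X ** mat (inverse f)) = mat f ** (X ** matrix_inv X) ** mat (inverse f)"
    unfolding fX by (simp add: matrix_mul_assoc)
  also have "\<dots> = mat 1" by (simp add: matrix_inv_mult[OF inv(1)] mm)
  finally have *: "(mat f - A) ** (matrix_inv X ** mat (inverse f)) = mat 1" .
  show "invertible (mat f - A)" by (rule matrix_inv_eqI(1)[OF *])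
  have "(rm_eval (matrix_inv X ** mat (inverse f)) \<longlongrightarrow> mat 1 ** mat 0) F"
    using inv(2) unfolding m1 by (intro rm_tendsto_mult rm_tendsto_mat assms)
  then show "(rm_eval (matrix_inv (mat f - A)) \<longlongrightarrow> 0) F"
    unfolding matrix_inv_eqI(2)[OF *] by simp
qed

end

text \<open>
  In lowest terms \<open>f = p / q\<close>, a zero of \<open>q\<close> at \<open>z\<close> would force \<open>p = q f\<close> to tend to \<open>0\<close> there as well.
\<close>

lemma rf_tendsto_imp_no_pole:
  assumes "(rf_eval f \<longlongrightarrow> l) (at z)"
  shows "z \<notin> rf_poles f"
proof
  define p q where "p = fst (quot_of_fract f)" and "q = snd (quot_of_fract f)"
  have f: "f = Fract p q" "coprime p q" "q \<noteq> 0"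
    by (auto simp: p_def q_def intro: coprime_quot_of_fract)
  assume "z \<in> rf_poles f"
  then have q: "poly q z = 0" by (simp add: rf_poles_def q_def)
  have p: "poly p z \<noteq> 0"
    using f(2) q by (metis coprime_poly_0)
  have "((\<lambda>s. poly q s * rf_eval f s) \<longlongrightarrow> poly q z * l) (at z)"
    by (intro tendsto_mult assms poly_isCont[unfolded isCont_def])
  moreover have "\<forall>\<^sub>F s in at z. poly q s * rf_eval f s = poly p s"
    by (rule eventually_mono[OF eventually_not_pole[OF generic_filter_at, where f = f]])
      (simp add: rf_eval_def rf_poles_def p_def q_def)
  ultimately have "(poly p \<longlongrightarrow> 0) (at z)"
    using q by (simp add: tendsto_cong)
  moreover have "(poly p \<longlongrightarrow> poly p z) (at z)"
    by (rule poly_isCont[unfolded isCont_def])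
  ultimately show False using p tendsto_unique[OF at_neq_bot] by blast
qed

lemma rm_tendsto_imp_no_pole:
  assumes "(rm_eval X \<longlongrightarrow> L) (at z)"
  shows "z \<notin> rm_poles X"
  using assms rf_tendsto_imp_no_pole unfolding rm_poles_def rm_tendsto_iff[OF generic_filter_at] by blast

lemma strictly_proper_iff: "strictly_proper X \<longleftrightarrow> (rm_eval X \<longlongrightarrow> 0) at_infinity"
  unfolding strictly_proper_def rm_tendsto_iff[OF generic_filter_at_infinity] by simp

lemma rf_tendsto_var: "(rf_eval rf_var \<longlongrightarrow> z) (at z)"
  unfolding rf_eval_var[abs_def] by (rule tendsto_ident_at)

lemma rf_var_nonzero: "rf_var \<noteq> 0"
  by (simp add: rf_var_def)

lemma rf_tendsto_inverse_var: "(rf_eval (inverse rf_var) \<longlongrightarrow> 0) at_infinity"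
proof (rule Lim_transform_eventually[OF tendsto_inverse_0])
  have "inverse rf_var = Fract 1 [:0, 1:]" by (simp add: rf_var_def to_fract_def)
  then have "inverse z = rf_eval (inverse rf_var) z" if "z \<notin> {0}" for z
    using that by (simp add: rf_eval_Fract divide_inverse)
  then show "\<forall>\<^sub>F z in at_infinity. inverse z = rf_eval (inverse rf_var) z"
    using generic_filter_at_infinity unfolding generic_filter_def
    by (auto elim!: eventually_mono allE[of _ "{0}"])
qed

section \<open>Reflection of rational matrix functions\<close>

text \<open>
  Any representation of \<open>f\<close> as a quotient may be used to compute its reflection, which makes
  reflection a ring homomorphism.
\<close>

lemma rf_reflect_Fract:
  assumes "q \<noteq> 0"
  shows "rf_reflect (Fract p q) = Fract (pcompose p [:0, -1:]) (pcompose q [:0, -1:])"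
proof -
  define a b where "a = fst (quot_of_fract (Fract p q))" and "b = snd (quot_of_fract (Fract p q))"
  have b: "b \<noteq> 0" by (simp add: b_def)
  have nz: "pcompose r [:0, -1:] \<noteq> 0" if "r \<noteq> 0" for r :: "complex poly"
    using that by (simp add: pcompose_eq_0_iff)
  have "Fract a b = Fract p q" by (simp add: a_def b_def)
  then have "a * q = p * b" using assms b by (simp add: eq_fract)
  then have "pcompose a [:0, -1:] * pcompose q [:0, -1:] = pcompose p [:0, -1:] * pcompose b [:0, -1:]"
    by (metis pcompose_mult)
  then show ?thesis unfolding rf_reflect_def a_def[symmetric] b_def[symmetric]
    using nz b assms by (simp add: eq_fract)
qed

lemma rf_reflect_add: "rf_reflect (f + g) = rf_reflect f + rf_reflect g"
  by (cases f; cases g) (simp add: rf_reflect_Fract pcompose_mult pcompose_add pcompose_eq_0_iff)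

lemma rf_reflect_mult: "rf_reflect (f * g) = rf_reflect f * rf_reflect g"
  by (cases f; cases g) (simp add: rf_reflect_Fract pcompose_mult)

lemma rf_reflect_const [simp]: "rf_reflect (rf_const c) = rf_const c"
  unfolding rf_const_def to_fract_def by (simp add: rf_reflect_Fract pcompose_1)

lemma rf_reflect_var: "rf_reflect rf_var = - rf_var"
  unfolding rf_var_def to_fract_def by (simp add: rf_reflect_Fract pcompose_pCons pcompose_1)

lemma rf_reflect_diff: "rf_reflect (f - g) = rf_reflect f - rf_reflect g"
  using rf_reflect_add[of "f - g" g] by (simp add: algebra_simps)

lemma rf_reflect_0 [simp]: "rf_reflect 0 = 0" and rf_reflect_1 [simp]: "rf_reflect 1 = 1"
  using rf_reflect_const[of 0] rf_reflect_const[of 1] by simp_all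

lemma rf_reflect_sum: "rf_reflect (\<Sum>i\<in>S. f i) = (\<Sum>i\<in>S. rf_reflect (f i))"
  by (induction S rule: infinite_finite_induct) (simp_all add: rf_reflect_add)

lemma rm_reflect_add: "rm_reflect (X + Y) = rm_reflect X + rm_reflect Y"
  by (simp add: vec_eq_iff rm_reflect_def rf_reflect_add)

lemma rm_reflect_diff: "rm_reflect (X - Y) = rm_reflect X - rm_reflect Y"
  by (simp add: vec_eq_iff rm_reflect_def rf_reflect_diff)

lemma rm_reflect_mult: "rm_reflect (X ** Y) = rm_reflect X ** rm_reflect Y"
  by (simp add: vec_eq_iff rm_reflect_def matrix_matrix_mult_def rf_reflect_sum rf_reflect_mult)

lemma rm_reflect_mat: "rm_reflect (mat f) = mat (rf_reflect f)"
  by (simp add: vec_eq_iff rm_reflect_def mat_def)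

lemma rm_reflect_of_real: "rm_reflect (rm_of_real X) = rm_of_real X"
  by (simp add: vec_eq_iff rm_reflect_def rm_of_real_def)

section \<open>Transfer functions\<close>

lemma rm_of_real_add: "rm_of_real (X + Y) = rm_of_real X + rm_of_real Y"
  by (simp add: vec_eq_iff rm_of_real_def rf_const_add)

lemma rm_of_real_diff: "rm_of_real (X - Y) = rm_of_real X - rm_of_real Y"
  by (simp add: vec_eq_iff rm_of_real_def rf_const_diff)

lemma rm_of_real_minus: "rm_of_real (- X) = - rm_of_real X"
  using rm_of_real_diff[of 0 X] by (simp add: vec_eq_iff rm_of_real_def)

lemma rm_of_real_mult: "rm_of_real (X ** Y) = rm_of_real X ** rm_of_real Y"
  by (simp add: vec_eq_iff rm_of_real_def matrix_matrix_mult_def rf_const_sum rf_const_mult)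

lemma rm_of_real_transpose: "rm_of_real (transpose X) = transpose (rm_of_real X)"
  by (simp add: vec_eq_iff rm_of_real_def transpose_def)

lemma strictly_proper_part_transfer_function:
  "strictly_proper_part (transfer_function A B C D) =
    rm_of_real C ** matrix_inv (mat rf_var - rm_of_real A) ** rm_of_real B"
  "strictly_proper (rm_of_real C ** matrix_inv (mat rf_var - rm_of_real A) ** rm_of_real B)"
proof -
  let ?P = "rm_of_real C ** matrix_inv (mat rf_var - rm_of_real A) ** rm_of_real B"
  have "(rm_eval ?P \<longlongrightarrow> cmat C ** 0 ** cmat B) at_infinity"
    by (intro rm_tendsto_mult rm_tendsto_of_real rf_tendsto_inverse_var rf_var_nonzero
      resolvent_tendsto_0(2)[OF _ rm_tendsto_of_real] generic_filter_at_infinity)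
  then have P: "(rm_eval ?P \<longlongrightarrow> 0) at_infinity" by simp
  then show "strictly_proper ?P" by (simp add: strictly_proper_iff)
  have "(rm_eval (transfer_function A B C D) \<longlongrightarrow> 0 + cmat D) at_infinity"
    unfolding transfer_function_def by (intro rm_tendsto_add P rm_tendsto_of_real generic_filter_at_infinity)
  then have "Lim at_infinity (rm_eval (transfer_function A B C D)) = cmat D"
    by (simp add: tendsto_Lim trivial_limit_at_infinity)
  then show "strictly_proper_part (transfer_function A B C D) = ?P"
    unfolding strictly_proper_part_def transfer_function_def
    by (simp add: rm_of_real_def vec_eq_iff)
qed

lemma resolvent_tendsto:
  assumes "generic_filter F" "(rf_eval f \<longlongrightarrow> z) F" "invertible (mat z - cmat A)"
  shows "(rm_eval (matrix_inv (mat f - rm_of_real A)) \<longlongrightarrow> matrix_inv (mat z - cmat A)) F"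
  by (intro rm_tendsto_matrix_inv(2) rm_tendsto_diff rm_tendsto_mat rm_tendsto_of_real assms)

section \<open>The stable part\<close>

text \<open>
  The matrices \<open>T\<close> and \<open>U\<close> are the resolvents at \<open>- s\<close> and \<open>s\<close>.  The Lyapunov equation expresses
  \<open>h\<^sup>T h\<close> by their inverses, which splits \<open>T h\<^sup>T h U\<close> into the partial fractions \<open>q U\<close> and \<open>T q\<close>.
\<close>

lemma lyapunov_factor_identity:
  fixes a q :: "'a::field^'n^'n" and b bn :: "'a^'m^'n" and c h :: "'a^'n^'m"
  assumes T: "T ** (mat (- s) - transpose a) = mat 1" and U: "(mat s - a) ** U = mat 1"
    and lyap: "transpose h ** h = - (transpose a ** q + q ** a)"
    and rh: "rh ** h = c - transpose b ** q"
  shows "(transpose b ** T ** transpose h + rh) ** (h ** U ** bn) =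
    c ** U ** bn + transpose b ** T ** q ** bn"
proof -
  have "mat (- s) ** q = - (mat s ** q)" by (simp add: vec_eq_iff mat_mult_component)
  then have h: "transpose h ** h = (mat (- s) - transpose a) ** q + q ** (mat s - a)"
    unfolding lyap by (simp add: matrix_diff_ldistrib matrix_diff_rdistrib mat_mult_commute)
  have "T ** transpose h ** h ** U = T ** (transpose h ** h) ** U"
    by (simp add: matrix_mul_assoc)
  also have "\<dots> = (T ** (mat (- s) - transpose a)) ** q ** U + T ** q ** ((mat s - a) ** U)"
    unfolding h by (simp add: matrix_add_ldistrib matrix_add_rdistrib matrix_mul_assoc)
  also have "\<dots> = q ** U + T ** q" unfolding T U by simp
  finally have *: "T ** transpose h ** h ** U = q ** U + T ** q" .
  have "(transpose b ** T ** transpose h + rh) ** (h ** U ** bn) =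
    transpose b ** (T ** transpose h ** h ** U) ** bn + (rh ** h) ** U ** bn"
    by (simp add: matrix_add_rdistrib matrix_mul_assoc)
  also have "\<dots> = c ** U ** bn + transpose b ** T ** q ** bn"
    unfolding * rh by (simp add: matrix_add_ldistrib matrix_add_rdistrib matrix_diff_rdistrib matrix_mul_assoc)
  finally show ?thesis .
qed

theorem theorem3:
  fixes A :: "real^'n^'n" and B :: "real^'m^'n" and C :: "real^'n^'m" and D :: "real^'m^'m"
    and R Rhalf :: "real^'m^'m" and QM PN :: "real^'n^'n"
    and CM CY :: "real^'n^'m" and BN BX :: "real^'m^'n"
    and M N G_sA G_B G_C :: "ratfun^'m^'m"
  assumes "minimal_system A B C"
    and "hurwitz A"
    and "strictly_positive_real (transfer_function A B C D)"
    and "R = D + transpose D" and "pos_def R"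
    and "pos_def Rhalf" and "Rhalf ** Rhalf = R"
    and "minimal_solution (riccati_M A B C D) QM"
    and "minimal_solution (riccati_N A B C D) PN"
    and "CM = matrix_inv Rhalf ** (C - transpose B ** QM)"
    and "M = transfer_function A B CM Rhalf"
    and "BN = (B - PN ** transpose C) ** matrix_inv Rhalf"
    and "N = transfer_function A BN C Rhalf"
    and "BX = BN" and "CY = CM"
    and "G_sA = rm_of_real CY ** matrix_inv (mat rf_var - rm_of_real A) ** rm_of_real BX"
    and "G_B = rm_of_real CY ** matrix_inv (mat rf_var - rm_of_real A) ** rm_of_real B"
    and "G_C = rm_of_real C ** matrix_inv (mat rf_var - rm_of_real A) ** rm_of_real BX"
  shows "G_sA = stable_part (matrix_inv (transpose (rm_reflect M)) ** strictly_proper_part N) \<and>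
         G_B = strictly_proper_part M \<and>
         G_C = strictly_proper_part N"
proof (intro conjI)
  show "G_B = strictly_proper_part M" "G_C = strictly_proper_part N"
    using assms by (simp_all add: strictly_proper_part_transfer_function)
  define Ri where "Ri = matrix_inv Rhalf"
  have iR: "invertible Rhalf" using assms(6) by (rule pos_def_invertible)
  have Rh: "Rhalf ** Ri = mat 1" "Ri ** Rhalf = mat 1" using matrix_inv_mult[OF iR] by (simp_all add: Ri_def)
  have sRh: "transpose Rhalf = Rhalf" using assms(6) by (simp add: pos_def_def)
  have sRi: "transpose Ri = Ri" using transpose_matrix_inv[OF iR] by (simp add: Ri_def sRh)
  have "R ** (Ri ** Ri) = Rhalf ** (Rhalf ** Ri) ** Ri"
    by (simp add: assms(7)[symmetric] matrix_mul_assoc)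
  then have R: "matrix_inv (D + transpose D) = Ri ** Ri"
    using matrix_inv_eqI(2)[of R "Ri ** Ri"] by (simp add: Rh assms(4))
  have CM: "CM = Ri ** (C - transpose B ** QM)" using assms(10) by (simp add: Ri_def)
  define F where "F = A - B ** Ri ** CM"
  have F: "F = A - B ** Ri ** (Ri ** (C - transpose B ** QM))" by (simp add: F_def CM)
  define U where "U = matrix_inv (mat rf_var - rm_of_real A)"
  define V where "V = matrix_inv (mat (- rf_var) - rm_of_real A)"
  have var: "(rf_eval (- rf_var) \<longlongrightarrow> - z) (at z)" for z
    using rf_tendsto_diff[OF generic_filter_at rf_tendsto_0[OF generic_filter_at] rf_tendsto_var] by simp
  have var_inf: "(rf_eval (inverse (- rf_var)) \<longlongrightarrow> 0) at_infinity"
    using rf_tendsto_diff[OF generic_filter_at_infinity rf_tendsto_0[OF generic_filter_at_infinity] rf_tendsto_inverse_var] 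
    by simp
  note inf = generic_filter_at_infinity
  note U_inf = resolvent_tendsto_0[OF inf rm_tendsto_of_real[OF inf, of A] rf_var_nonzero rf_tendsto_inverse_var, folded U_def]
  have "- rf_var \<noteq> 0" using rf_var_nonzero by simp
  note V_inf = resolvent_tendsto_0[OF inf rm_tendsto_of_real[OF inf, of A] this var_inf, folded V_def]
  have UU: "(mat rf_var - rm_of_real A) ** U = mat 1" unfolding U_def by (rule matrix_inv_mult[OF U_inf(1)])
  \<comment> \<open>Reflecting the resolvent of \<open>A\<close> at \<open>s\<close> gives its resolvent at \<open>- s\<close>.\<close>
  have "(mat (- rf_var) - rm_of_real A) ** rm_reflect U = mat 1"
    using arg_cong[OF UU, of rm_reflect]
    by (simp add: rm_reflect_mult rm_reflect_diff rm_reflect_mat rm_reflect_of_real rf_reflect_var)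
  then have refl_U: "rm_reflect U = V" unfolding V_def by (rule matrix_inv_eqI(2)[symmetric])
  define T where "T = transpose (rm_reflect M)"
  have T: "T = transpose (rm_of_real B) ** transpose V ** transpose (rm_of_real CM) + rm_of_real Rhalf"
    unfolding T_def assms(11) transfer_function_def U_def[symmetric]
    by (simp add: rm_reflect_add rm_reflect_mult rm_reflect_of_real refl_U transpose_add
      matrix_transpose_mul matrix_mul_assoc rm_of_real_transpose[symmetric] sRh)
  define P where "P = rm_of_real CM ** U ** rm_of_real BN"
  define N0 where "N0 = rm_of_real C ** U ** rm_of_real BN"
  define H where "H = transpose (rm_of_real B) ** transpose V ** rm_of_real QM ** rm_of_real BN"
  have TP: "T ** P = N0 + H"
    unfolding T P_def N0_def H_def
  proof (rule lyapunov_factor_identity[OF _ UU])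
    show "transpose V ** (mat (- rf_var) - transpose (rm_of_real A)) = mat 1"
      using arg_cong[OF matrix_inv_mult(1)[OF V_inf(1)], of transpose, folded V_def]
      by (simp add: matrix_transpose_mul transpose_diff)
    have "riccati_M A B C D QM = 0" using assms(8) by (simp add: minimal_solution_def)
    moreover have "transpose CM ** CM = transpose (C - transpose B ** QM) ** (Ri ** Ri) ** (C - transpose B ** QM)"
      unfolding CM matrix_transpose_mul sRi by (simp add: matrix_mul_assoc)
    ultimately have "transpose CM ** CM = - (transpose A ** QM + QM ** A)"
      unfolding riccati_M_def R by (metis add.commute eq_neg_iff_add_eq_0)
    then show "transpose (rm_of_real CM) ** rm_of_real CM = 
      - (transpose (rm_of_real A) ** rm_of_real QM + rm_of_real QM ** rm_of_real A)"
      by (metis rm_of_real_minus rm_of_real_add rm_of_real_mult rm_of_real_transpose)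
    have "Rhalf ** CM = C - transpose B ** QM" unfolding CM by (simp add: matrix_mul_assoc Rh)
    then show "rm_of_real Rhalf ** rm_of_real CM = rm_of_real C - transpose (rm_of_real B) ** rm_of_real QM"
      by (metis rm_of_real_diff rm_of_real_mult rm_of_real_transpose)
  qed
  have V_at: "(rm_eval V \<longlongrightarrow> matrix_inv (mat (- z) - cmat A)) (at z)"
    and A_at: "invertible (mat (- z) - cmat A)" if "Re z < 0" for z
  proof -
    show "invertible (mat (- z) - cmat A)" using that by (intro hurwitz_resolvent assms) simp
    then show "(rm_eval V \<longlongrightarrow> matrix_inv (mat (- z) - cmat A)) (at z)"
      unfolding V_def by (intro resolvent_tendsto generic_filter_at var)
  qed
  have T_lim: "(rm_eval T \<longlongrightarrow> transpose (cmat CM ** L ** cmat B + cmat Rhalf)) G"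
    if "generic_filter G" "(rm_eval V \<longlongrightarrow> L) G" for L G
  proof -
    have "(rm_eval T \<longlongrightarrow> transpose (cmat B) ** transpose L ** transpose (cmat CM) + cmat Rhalf) G"
      unfolding T by (intro rm_tendsto_add rm_tendsto_mult rm_tendsto_transpose rm_tendsto_of_real that)
    then show ?thesis 
      by (simp add: transpose_add matrix_transpose_mul matrix_mul_assoc cmat_transpose[symmetric] sRh)
  qed
  have H_lim: "(rm_eval H \<longlongrightarrow> transpose (cmat B) ** transpose L ** cmat QM ** cmat BN) G"
    if "generic_filter G" "(rm_eval V \<longlongrightarrow> L) G" for L G
    unfolding H_def by (intro rm_tendsto_add rm_tendsto_mult rm_tendsto_transpose rm_tendsto_of_real that)
  have T_inf: "(rm_eval T \<longlongrightarrow> cmat Rhalf) at_infinity"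
    using T_lim[OF inf V_inf(2)] by (simp add: cmat_transpose[symmetric] sRh)
  have "cmat Rhalf ** cmat Ri = mat 1" unfolding cmat_mult[symmetric] Rh cmat_mat_1 ..
  then have iRc: "invertible (cmat Rhalf)" by (rule matrix_inv_eqI(1))
  note Ti_inf = rm_tendsto_matrix_inv[OF inf T_inf iRc]
  \<comment> \<open>A zero of \<open>T\<close> at \<open>z\<close> would make \<open>- z\<close> an eigenvalue of \<open>F\<close> in the open right half-plane.\<close>
  have T_at: "invertible (transpose (cmat CM ** matrix_inv (mat (- z) - cmat A) ** cmat B + cmat Rhalf))" 
    if "Re z < 0" for z
  proof -
    have "w = 0" if w: "cmat (transpose F) *v w = (- z) *s w" for w
      using minimal_solution_closed_loop_eigenvalue[OF assms(2) assms(8) sRi R F w] \<open>Re z < 0\<close> by force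
    then have "invertible (cmat CM ** matrix_inv (mat (- z) - cmat A) ** cmat B + cmat Rhalf)"
      by (rule transfer_matrix_invertible[OF A_at[OF that] Rh(1) F_def])
    then show ?thesis by (simp add: invertible_det_nz)
  qed
  have N: "strictly_proper_part N = N0"
    unfolding assms(13) strictly_proper_part_transfer_function N0_def U_def ..
  have "matrix_inv T ** (T ** P) = P" by (simp add: matrix_mul_assoc matrix_inv_mult[OF Ti_inf(1)])
  \<comment> \<open>Written with \<open>0 -\<close> so that the limit rule for differences applies.\<close>
  then have diff: "matrix_inv T ** N0 - P = 0 - matrix_inv T ** H"
    unfolding TP matrix_add_ldistrib by (simp add: algebra_simps)
  have "is_stable_part (matrix_inv T ** N0) P"
    unfolding is_stable_part_def
  proof (intro conjI)
    show "strictly_proper P" unfolding P_def U_def by (rule strictly_proper_part_transfer_function)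
    show "rm_poles P \<subseteq> {z. Re z < 0}"
    proof (rule subsetI, rule ccontr)
      fix z assume z: "z \<in> rm_poles P" "z \<notin> {z. Re z < 0}"
      then have "invertible (mat z - cmat A)" by (intro hurwitz_resolvent assms) simp
      then have "(rm_eval P \<longlongrightarrow> cmat CM ** matrix_inv (mat z - cmat A) ** cmat BN) (at z)"
        unfolding P_def U_def
        by (intro rm_tendsto_mult rm_tendsto_of_real resolvent_tendsto generic_filter_at rf_tendsto_var)
      then show False using z(1) rm_tendsto_imp_no_pole by blast
    qed
    have "(rm_eval (0 - matrix_inv T ** H) \<longlongrightarrow> 0 - matrix_inv (cmat Rhalf) ** 
      (transpose (cmat B) ** transpose 0 ** cmat QM ** cmat BN)) at_infinity"
      using rm_tendsto_mat[OF inf rf_tendsto_0[OF inf]] 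
      by (intro rm_tendsto_diff rm_tendsto_mult Ti_inf H_lim inf V_inf(2)) simp_all
    then show "strictly_proper (matrix_inv T ** N0 - P)"
      unfolding diff strictly_proper_iff by (simp add: transpose_def zero_vec_def[symmetric])
    show "rm_poles (matrix_inv T ** N0 - P) \<inter> {z. Re z < 0} = {}"
    proof -
      have "z \<notin> rm_poles (0 - matrix_inv T ** H)" if z: "Re z < 0" for z
      proof (rule rm_tendsto_imp_no_pole)
        show "(rm_eval (0 - matrix_inv T ** H) \<longlongrightarrow> mat 0 - 
          matrix_inv (transpose (cmat CM ** matrix_inv (mat (- z) - cmat A) ** cmat B + cmat Rhalf)) ** 
          (transpose (cmat B) ** transpose (matrix_inv (mat (- z) - cmat A)) ** cmat QM ** cmat BN)) (at z)"
          unfolding mat_0[symmetric]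
          by (intro rm_tendsto_diff rm_tendsto_mult rm_tendsto_matrix_inv(2) T_lim H_lim V_at T_at z
            rm_tendsto_mat rf_tendsto_0 generic_filter_at)
      qed
      then show ?thesis unfolding diff by blast
    qed
  qed
  then show "G_sA = stable_part (matrix_inv (transpose (rm_reflect M)) ** strictly_proper_part N)"
    unfolding T_def[symmetric] N assms(14,15,16) P_def[unfolded U_def, symmetric]
    by (rule stable_part_eqI[symmetric])
qed

end
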